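(* Let $q\in[0,2]$. Consider the differential comparison model $X_{ij}=\theta_{r(i)}-\theta_{r(j)}+Z_{ij}$, $1\le i\neq j\le n$, with known $\theta_1,\dots,\theta_n\in\mathbb R$, and assume the noise condition (N) and conditions (D1) and (D2). Define the scores $$S_i=\frac1{2n}\sum_{j\in[n]\setminus\{i\}}(X_{ij}-X_{ji})+\frac1n\sum_{j=1}^n\theta_j,\qquad i\in[n],$$ and let $$\hat r\in\mathop{\mathrm{argmin}}_{r\in\mathcal R}\sum_{i=1}^n(S_i-\theta_{r(i)})^2 .$$ Then there exist a constant $C>0$ independent of $n$ and a sequence $\eta_n\to0$ such that, for all $n$, $$\sup_{r\in\mathcal R}\mathbb E_r\,\ell_q(\hat r,r)\le C\begin{cases}\exp\left(-(1+\eta_n)s_n\right), & s_n>1,\\[2pt] s_n^{-q/2}\wedge n^q, & s_n\le 1,\end{cases}\qquad\text{where } s_n=\frac{n\beta^2}{4\sigma^2}$$ (if $\beta=0$, the bound in the second case is read as $n^q$). Moreover, when $\liminf_{n}\frac{n\beta^2}{4\sigma^2\log n}>1$, we have $\hat r=r$ with probability $1-o(1)$, i.e. $\inf_{r\in\mathcal R}\mathbb P_r(\hat r=r)\to1$ as $n\to\infty$.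
   Context: Write $[n]=\{1,\dots,n\}$, $a\wedge b=\min(a,b)$, and let $\|\cdot\|$ be the Euclidean norm on $\mathbb R^n$. All model quantities may depend on $n$, and asymptotics are as $n\to\infty$. Rank space: $\mathcal R=\{r=(r(1),\dots,r(n))\in[n]^n:\ |\sum_{i=1}^n r(i)-\sum_{i=1}^n i|\le c_n\}$, where $c_n$ satisfies $1\le c_n=o(\sqrt n)$. For $r\in\mathcal R$, $\mathbb P_r$ (with expectation $\mathbb E_r$) is the law of the observations $\{X_{ij}\}_{1\le i\ne j\le n}$ when the true rank vector is $r$. (N) Noise condition, with parameter $\sigma>0$: for every $t>0$ and all reals $(v_{ij})_{1\le i\neq j\le n}$ with $\sum_{i\ne j}v_{ij}^2=1$, $\mathbb P(\sum_{1\le i\ne j\le n}v_{ij}Z_{ij}>t)\le\exp(-t^2/(2\sigma^2))$. (D1) With parameter $\beta\in\mathbb R$: for all $r,\tilde r\in\mathcal R$, $\sum_{i=1}^n(\theta_{r(i)}-\theta_{\tilde r(i)})^2\ge\beta^2\|\tilde r-r\|^2$. (D2) $\max_{r\in\mathcal R}|\sum_{i=1}^n\theta_{r(i)}-\sum_{i=1}^n\theta_i|=o(\sqrt n\,\beta)$, i.e. it is at most $\varepsilon_n\sqrt n|\beta|$ for some sequence $\varepsilon_n\to0$. Loss: $\ell_0(\hat r,r)=\frac1n\sum_{i=1}^n\mathbb I\{\hat r(i)\ne r(i)\}$, and $\ell_q(\hat r,r)=\frac1n\sum_{i=1}^n|\hat r(i)-r(i)|^q$ for $q\in(0,2]$.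 *)

theory Defs
  imports "HOL-Probability.Probability" "HOL-Library.Landau_Symbols"
begin

text \<open>
  Rank vectors are extensional functions on \<open>{1..n}\<close>, so that equality of functions is
  equality of vectors in \<open>[n]^n\<close> and the rank space is finite.
\<close>
definition rank_space :: "nat \<Rightarrow> real \<Rightarrow> (nat \<Rightarrow> nat) set" where
  "rank_space n c =
     {r \<in> {1..n} \<rightarrow>\<^sub>E {1..n}. \<bar>(\<Sum>i=1..n. real (r i)) - (\<Sum>i=1..n. real i)\<bar> \<le> c}"

definition off_diag :: "nat \<Rightarrow> (nat \<times> nat) set" where
  "off_diag n = {(i, j). i \<in> {1..n} \<and> j \<in> {1..n} \<and> i \<noteq> j}"

text \<open>Joint sub-Gaussianity of the noise array; the \<open>Z i j\<close> need not be independent.\<close>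
definition noise_condition ::
    "'a measure \<Rightarrow> nat \<Rightarrow> (nat \<Rightarrow> nat \<Rightarrow> 'a \<Rightarrow> real) \<Rightarrow> real \<Rightarrow> bool" where
  "noise_condition M n Z \<sigma> \<longleftrightarrow>
     (\<forall>t v. t > 0 \<longrightarrow> (\<Sum>(i, j)\<in>off_diag n. (v i j :: real)\<^sup>2) = 1 \<longrightarrow>
        measure M {\<omega> \<in> space M. (\<Sum>(i, j)\<in>off_diag n. v i j * Z i j \<omega>) > t}
          \<le> exp (- t\<^sup>2 / (2 * \<sigma>\<^sup>2)))"

text \<open>
  The differential comparison model for a true rank vector \<open>r\<close>: \<open>M\<close> is the probability
  measure governing the observations \<open>X\<close> when the truth is \<open>r\<close>, and \<open>Z\<close> is the noise.
\<close>
definition differential_comparison_model ::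
    "'a measure \<Rightarrow> nat \<Rightarrow> (nat \<Rightarrow> real) \<Rightarrow> (nat \<Rightarrow> nat) \<Rightarrow>
     (nat \<Rightarrow> nat \<Rightarrow> 'a \<Rightarrow> real) \<Rightarrow> (nat \<Rightarrow> nat \<Rightarrow> 'a \<Rightarrow> real) \<Rightarrow> bool" where
  "differential_comparison_model M n \<theta> r X Z \<longleftrightarrow>
     prob_space M \<and>
     (\<forall>(i, j)\<in>off_diag n. Z i j \<in> borel_measurable M \<and>
        (\<forall>\<omega>\<in>space M. X i j \<omega> = \<theta> (r i) - \<theta> (r j) + Z i j \<omega>))"

definition cond_D1 :: "nat \<Rightarrow> real \<Rightarrow> (nat \<Rightarrow> real) \<Rightarrow> real \<Rightarrow> bool" where
  "cond_D1 n c \<theta> \<beta> \<longleftrightarrow>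
     (\<forall>r\<in>rank_space n c. \<forall>r'\<in>rank_space n c.
        (\<Sum>i=1..n. (\<theta> (r i) - \<theta> (r' i))\<^sup>2) \<ge> \<beta>\<^sup>2 * (\<Sum>i=1..n. (real (r' i) - real (r i))\<^sup>2))"

text \<open>
  The maximum is \<open>o(sqrt n * \<beta>)\<close>, with the bounding sequence \<open>\<epsilon>\<close> valid for every \<open>n \<ge> 1\<close>.
\<close>
definition cond_D2 ::
    "(nat \<Rightarrow> real) \<Rightarrow> (nat \<Rightarrow> nat \<Rightarrow> real) \<Rightarrow> (nat \<Rightarrow> real) \<Rightarrow> bool" where
  "cond_D2 c \<theta> \<beta> \<longleftrightarrow>
     (\<exists>\<epsilon> :: nat \<Rightarrow> real. \<epsilon> \<longlonglongrightarrow> 0 \<and>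
        (\<forall>n\<ge>1. Max ((\<lambda>r. \<bar>(\<Sum>i=1..n. \<theta> n (r i)) - (\<Sum>i=1..n. \<theta> n i)\<bar>) ` rank_space n (c n))
          \<le> \<epsilon> n * sqrt (real n) * \<bar>\<beta> n\<bar>))"

definition score :: "nat \<Rightarrow> (nat \<Rightarrow> real) \<Rightarrow> (nat \<Rightarrow> nat \<Rightarrow> real) \<Rightarrow> nat \<Rightarrow> real" where
  "score n \<theta> x i =
     1 / (2 * real n) * (\<Sum>j\<in>{1..n} - {i}. x i j - x j i) + 1 / real n * (\<Sum>j=1..n. \<theta> j)"

definition is_rank_estimate ::
    "nat \<Rightarrow> real \<Rightarrow> (nat \<Rightarrow> real) \<Rightarrow> (nat \<Rightarrow> nat \<Rightarrow> real) \<Rightarrow> (nat \<Rightarrow> nat) \<Rightarrow> bool" where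
  "is_rank_estimate n c \<theta> x rhat \<longleftrightarrow>
     is_arg_min (\<lambda>r. \<Sum>i=1..n. (score n \<theta> x i - \<theta> (r i))\<^sup>2) (\<lambda>r. r \<in> rank_space n c) rhat"

definition rank_loss :: "real \<Rightarrow> nat \<Rightarrow> (nat \<Rightarrow> nat) \<Rightarrow> (nat \<Rightarrow> nat) \<Rightarrow> real" where
  "rank_loss q n rhat r =
     1 / real n * (\<Sum>i=1..n. if q = 0 then of_bool (rhat i \<noteq> r i)
                              else \<bar>real (rhat i) - real (r i)\<bar> powr q)"

definition signal :: "nat \<Rightarrow> real \<Rightarrow> real \<Rightarrow> real" where
  "signal n \<beta> \<sigma> = real n * \<beta>\<^sup>2 / (4 * \<sigma>\<^sup>2)"

text \<open>
  The case \<open>\<beta> = 0\<close> is separate because the negative power of \<open>0\<close> is to be read as infinite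
  there, whereas \<open>0 powr a = 0\<close> in HOL.
\<close>
definition rate :: "real \<Rightarrow> nat \<Rightarrow> real \<Rightarrow> real \<Rightarrow> real \<Rightarrow> real" where
  "rate q n \<beta> \<sigma> \<eta> =
     (if signal n \<beta> \<sigma> > 1 then exp (- (1 + \<eta>) * signal n \<beta> \<sigma>)
      else if \<beta> = 0 then real n powr q
      else min (signal n \<beta> \<sigma> powr (- q / 2)) (real n powr q))"

end

theory Submission imports Defs begin

text \<open>
  Write \<open>D r' = \<Sum>i. (r' i - r i)\<^sup>2\<close> for the squared distance of a rank vector \<open>r'\<close> to the true one,
  \<open>d i = \<theta> (r' i) - \<theta> (r i)\<close>, and \<open>s = n \<beta>\<^sup>2 / (4 \<sigma>\<^sup>2)\<close> for the signal. The score is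
  \<open>S i = \<theta> (r i) + \<delta> + \<zeta> i\<close>, where \<open>\<zeta>\<close> is linear in the noise and \<open>\<delta>\<close> does not depend on \<open>i\<close>. If \<open>r'\<close> is
  a least squares estimate, comparing it with \<open>r\<close> gives
  \<open>\<Sum>i. (d i)\<^sup>2 \<le> 2 * (\<Sum>i. d i * \<zeta> i) + 2 * \<delta> * (\<Sum>i. d i)\<close>, and (D2) bounds the last term by
  \<open>4 \<epsilon>\<^sup>2 \<beta>\<^sup>2\<close> (lemma \<open>basic_inequality\<close>).

  Large signal. As an array of coefficients of the noise, \<open>\<Sum>i. d i * \<zeta> i\<close> has squared norm at most
  \<open>(\<Sum>i. (d i)\<^sup>2) / (2 n)\<close>, so (N) and (D1) show, for small \<open>\<epsilon>\<close>, that a given \<open>r'\<close> is selected with probability at most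
  \<open>exp (- s' * D r')\<close>, where \<open>s' = (1 - 4 \<epsilon>\<^sup>2)\<^sup>2 s = (1 + o(1)) s\<close> (lemma \<open>prob_rhat_eq_le\<close>). The sum of
  \<open>exp (- t * D r')\<close> over all \<open>r' \<in> [n]^n\<close> factorizes over the coordinates and is at most
  \<open>exp (10 n exp (- t))\<close> for \<open>t \<ge> 1/4\<close>. Hence the exponential moment of \<open>D rhat / 2\<close> is at most \<open>exp b\<close> with
  \<open>b = 10 n exp (1/2 - s')\<close>, and by convexity of \<open>exp\<close> the expectation of \<open>D rhat\<close> is at most \<open>2 b\<close>. This
  proves the exponential rate without a union bound over the number of errors, because the loss is at
  most \<open>D rhat / n\<close>. It also gives exact recovery, since \<open>1 - P (rhat = r) \<le> E (D rhat)\<close> and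
  \<open>n exp (- s') \<rightarrow> 0\<close> when the \<open>liminf\<close> of \<open>s / ln n\<close> exceeds 1.

  Small signal. Here the union bound would lose a logarithm. Instead, the basic inequality and
  \<open>2 x y \<le> x\<^sup>2 / 2 + 2 y\<^sup>2\<close> yield \<open>\<beta>\<^sup>2 * D rhat \<le> 4 * (\<Sum>i. (\<zeta> i)\<^sup>2) + 8 \<epsilon>\<^sup>2 \<beta>\<^sup>2\<close>, and the second moments of
  the \<open>\<zeta> i\<close> give \<open>E (D rhat) \<le> 3 n / s + 8 \<epsilon>\<^sup>2\<close> (lemma \<open>expected_sq_dist_le\<close>). The bound for the power \<open>q\<close>
  follows from \<open>\<bar>k\<bar> powr q \<le> s powr (- q / 2) * (1 + s k\<^sup>2)\<close>. The same moment bound covers the finitely many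
  \<open>n\<close> for which \<open>\<epsilon>\<close> is not yet small; there the exponent \<open>1 + \<eta>\<close> is set to 0.
\<close>

section \<open>Linear functionals of the noise\<close>

text \<open>
  The noise part of the score. For a noise array \<open>z\<close> this is \<open>\<zeta> i\<close>, the score minus its
  deterministic part.
\<close>
definition noise_score :: "nat \<Rightarrow> (nat \<Rightarrow> nat \<Rightarrow> real) \<Rightarrow> nat \<Rightarrow> real" where
  "noise_score n z i = 1 / (2 * real n) * (\<Sum>j\<in>{1..n} - {i}. z i j - z j i)"

lemma off_diag_eq_Sigma: "off_diag n = (SIGMA i:{1..n}. {1..n} - {i})"
  by (auto simp: off_diag_def)

lemma finite_off_diag [simp]: "finite (off_diag n)"
  by (simp add: off_diag_eq_Sigma)

lemma sum_off_diag: "(\<Sum>(i, j)\<in>off_diag n. f i j) = (\<Sum>i=1..n. \<Sum>j\<in>{1..n} - {i}. f i j)"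
  unfolding off_diag_eq_Sigma by (subst sum.Sigma) auto

lemma sum_off_diag_swap:
  "(\<Sum>(i, j)\<in>off_diag n. f i j) = (\<Sum>(i, j)\<in>off_diag n. f j i)"
  by (rule sum.reindex_bij_witness[where i = prod.swap and j = prod.swap])
     (auto simp: off_diag_def)

lemma sum_noise_score:
  "(\<Sum>i=1..n. d i * noise_score n z i) = (\<Sum>(i, j)\<in>off_diag n. (d i - d j) / (2 * real n) * z i j)"
proof -
  have "(\<Sum>i=1..n. d i * noise_score n z i)
      = (\<Sum>(i, j)\<in>off_diag n. d i / (2 * real n) * z i j - d i / (2 * real n) * z j i)"
    unfolding sum_off_diag noise_score_def
    by (simp add: sum_distrib_left right_diff_distrib)
  also have "\<dots> = (\<Sum>(i, j)\<in>off_diag n. d i / (2 * real n) * z i j)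
      - (\<Sum>(i, j)\<in>off_diag n. d i / (2 * real n) * z j i)"
    by (simp add: sum_subtractf case_prod_unfold)
  also have "(\<Sum>(i, j)\<in>off_diag n. d i / (2 * real n) * z j i)
      = (\<Sum>(i, j)\<in>off_diag n. d j / (2 * real n) * z i j)"
    by (rule sum_off_diag_swap)
  finally show ?thesis
    by (simp add: sum_subtractf [symmetric] case_prod_unfold diff_divide_distrib left_diff_distrib)
qed

lemma sum_sq_coeff_le:
  "(\<Sum>(i, j)\<in>off_diag n. ((d i - d j) / (2 * real n))\<^sup>2) \<le> (\<Sum>i=1..n. (d i)\<^sup>2) / (2 * real n)"
proof (cases "n = 0")
  case False
  have "(\<Sum>(i, j)\<in>off_diag n. ((d i - d j) / (2 * real n))\<^sup>2)
      = (\<Sum>i=1..n. \<Sum>j=1..n. ((d i - d j) / (2 * real n))\<^sup>2)"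
    unfolding sum_off_diag by (intro sum.cong refl sum.mono_neutral_left) auto
  also have "\<dots> = (\<Sum>i=1..n. \<Sum>j=1..n. (d i)\<^sup>2 + (d j)\<^sup>2 - 2 * (d i * d j)) / (2 * real n)\<^sup>2"
    by (simp add: power_divide sum_divide_distrib power2_diff algebra_simps)
  also have "(\<Sum>i=1..n. \<Sum>j=1..n. (d i)\<^sup>2 + (d j)\<^sup>2 - 2 * (d i * d j))
      = 2 * real n * (\<Sum>i=1..n. (d i)\<^sup>2) - 2 * (\<Sum>i=1..n. d i)\<^sup>2"
    by (simp add: sum.distrib sum_subtractf sum_distrib_left [symmetric] sum_distrib_right [symmetric]
        power2_eq_square)
  also have "\<dots> \<le> 2 * real n * (\<Sum>i=1..n. (d i)\<^sup>2)"
    by simp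
  finally show ?thesis
    using False by (simp add: divide_right_mono power2_eq_square divide_simps split: if_splits)
qed (simp add: off_diag_def)

text \<open>
  The noise condition for coefficient arrays of arbitrary norm. It also holds with a weak inequality in
  the event, by letting the threshold increase to \<open>x\<close>.
\<close>
lemma noise_condition_scaled:
  assumes "prob_space M" and N: "noise_condition M n Z \<sigma>"
    and meas: "\<And>i j. (i, j) \<in> off_diag n \<Longrightarrow> Z i j \<in> borel_measurable M"
    and "\<sigma> > 0" and x: "x > 0"
    and V: "(\<Sum>(i, j)\<in>off_diag n. (v i j)\<^sup>2) \<le> V"
  shows "measure M {\<omega> \<in> space M. (\<Sum>(i, j)\<in>off_diag n. v i j * Z i j \<omega>) \<ge> x}
           \<le> exp (- x\<^sup>2 / (2 * \<sigma>\<^sup>2 * V))"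
proof -
  interpret prob_space M by fact
  define W where "W \<omega> = (\<Sum>(i, j)\<in>off_diag n. v i j * Z i j \<omega>)" for \<omega>
  have [measurable]: "W \<in> borel_measurable M"
    unfolding W_def using meas by (intro borel_measurable_sum) auto
  define w where "w = sqrt (\<Sum>(i, j)\<in>off_diag n. (v i j)\<^sup>2)"
  have w2: "w\<^sup>2 = (\<Sum>(i, j)\<in>off_diag n. (v i j)\<^sup>2)"
    unfolding w_def by (intro real_sqrt_pow2 sum_nonneg) auto
  show ?thesis
  proof (cases "w = 0")
    case True
    then have "\<forall>p\<in>off_diag n. (case p of (i, j) \<Rightarrow> (v i j)\<^sup>2) = 0"
      using w2 by (subst sum_nonneg_eq_0_iff [symmetric]) auto
    then have "W \<omega> = 0" for \<omega>
      unfolding W_def by (intro sum.neutral) auto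
    then have "measure M {\<omega> \<in> space M. W \<omega> \<ge> x} = 0"
      using x by simp
    then show ?thesis
      by (simp add: W_def)
  next
    case False
    moreover have "w \<ge> 0"
      unfolding w_def by (intro real_sqrt_ge_zero sum_nonneg) auto
    ultimately have w: "w > 0" by simp
    have lt: "measure M {\<omega> \<in> space M. W \<omega> \<ge> x} \<le> exp (- (t / w)\<^sup>2 / (2 * \<sigma>\<^sup>2))"
      if t: "0 < t" "t < x" for t
    proof -
      have "(\<Sum>(i, j)\<in>off_diag n. (v i j / w)\<^sup>2) = 1"
        using w unfolding power_divide case_prod_unfold sum_divide_distrib [symmetric]
        by (simp add: w2 [unfolded case_prod_unfold, symmetric])
      moreover have "t / w > 0" using t w by simp
      ultimately have "measure M {\<omega> \<in> space M. (\<Sum>(i, j)\<in>off_diag n. v i j / w * Z i j \<omega>) > t / w}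
          \<le> exp (- (t / w)\<^sup>2 / (2 * \<sigma>\<^sup>2))"
        using N[unfolded noise_condition_def, rule_format, of "t / w" "\<lambda>i j. v i j / w"] by blast
      moreover have "(\<Sum>(i, j)\<in>off_diag n. v i j / w * Z i j \<omega>) = W \<omega> / w" for \<omega>
        by (simp add: W_def sum_divide_distrib case_prod_unfold)
      moreover have "measure M {\<omega> \<in> space M. W \<omega> \<ge> x} \<le> measure M {\<omega> \<in> space M. W \<omega> / w > t / w}"
        using t w by (intro finite_measure_mono) (auto simp: divide_strict_right_mono)
      ultimately show ?thesis by simp
    qed
    have "((\<lambda>t. exp (- (t / w)\<^sup>2 / (2 * \<sigma>\<^sup>2))) \<longlongrightarrow> exp (- (x / w)\<^sup>2 / (2 * \<sigma>\<^sup>2))) (at_left x)"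
      using w \<open>\<sigma> > 0\<close> by (intro tendsto_intros) auto
    moreover have "eventually (\<lambda>t. 0 < t \<and> t < x) (at_left x)"
      using x by (intro eventually_at_leftI[of 0]) auto
    then have "eventually (\<lambda>t. measure M {\<omega> \<in> space M. W \<omega> \<ge> x}
                  \<le> exp (- (t / w)\<^sup>2 / (2 * \<sigma>\<^sup>2))) (at_left x)"
      by eventually_elim (use lt in auto)
    ultimately have "measure M {\<omega> \<in> space M. W \<omega> \<ge> x} \<le> exp (- (x / w)\<^sup>2 / (2 * \<sigma>\<^sup>2))"
      by (intro tendsto_lowerbound) auto
    also have "\<dots> = exp (- (x\<^sup>2 / (2 * \<sigma>\<^sup>2 * w\<^sup>2)))"
      by (simp add: power_divide mult_ac)
    also have "\<dots> \<le> exp (- (x\<^sup>2 / (2 * \<sigma>\<^sup>2 * V)))"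
    proof -
      have "0 < w\<^sup>2" "w\<^sup>2 \<le> V"
        using w V by (simp_all add: w2 [symmetric])
      moreover from this have "0 < V" by (rule less_le_trans)
      ultimately have "x\<^sup>2 / (2 * \<sigma>\<^sup>2 * V) \<le> x\<^sup>2 / (2 * \<sigma>\<^sup>2 * w\<^sup>2)"
        using \<open>\<sigma> > 0\<close> by (intro divide_left_mono mult_left_mono mult_pos_pos) auto
      then show ?thesis by simp
    qed
    finally show ?thesis
      by (simp add: W_def)
  qed
qed

lemma noise_score_tail:
  assumes "prob_space M" "noise_condition M n Z \<sigma>"
    and "\<And>i j. (i, j) \<in> off_diag n \<Longrightarrow> Z i j \<in> borel_measurable M"
    and "\<sigma> > 0" "x > 0"
  shows "measure M {\<omega> \<in> space M. (\<Sum>i=1..n. d i * noise_score n (\<lambda>i j. Z i j \<omega>) i) \<ge> x}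
           \<le> exp (- (real n * x\<^sup>2 / (\<sigma>\<^sup>2 * (\<Sum>i=1..n. (d i)\<^sup>2))))"
  unfolding sum_noise_score
  using noise_condition_scaled[OF assms sum_sq_coeff_le[of d n]] by (simp add: ac_simps)

text \<open>
  With \<open>y = W\<^sup>2 / \<tau>\<close>, a nonnegative number \<open>y\<close> is at most the number of \<open>k \<ge> 0\<close> with \<open>k \<le> y\<close>; summing
  the tail probabilities over \<open>k\<close> is a geometric series, which avoids an integral over the tail.
\<close>
lemma (in prob_space) second_moment_subgaussian:
  fixes W :: "'a \<Rightarrow> real"
  assumes W [measurable]: "W \<in> borel_measurable M" and \<tau>: "\<tau> > 0"
    and up: "\<And>x. x > 0 \<Longrightarrow> prob {\<omega> \<in> space M. W \<omega> \<ge> x} \<le> exp (- (x\<^sup>2 / (2 * \<tau>)))"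
    and lo: "\<And>x. x > 0 \<Longrightarrow> prob {\<omega> \<in> space M. - W \<omega> \<ge> x} \<le> exp (- (x\<^sup>2 / (2 * \<tau>)))"
  shows "integrable M (\<lambda>\<omega>. (W \<omega>)\<^sup>2)" "expectation (\<lambda>\<omega>. (W \<omega>)\<^sup>2) \<le> 6 * \<tau>"
proof -
  define A where "A k = {\<omega> \<in> space M. real k \<le> (W \<omega>)\<^sup>2 / \<tau>}" for k :: nat
  have A [measurable]: "A k \<in> sets M" for k
    unfolding A_def by measurable
  have PA: "emeasure M (A k) \<le> ennreal (2 * (2 / 3) ^ k)" for k
  proof (cases "k = 0")
    case True
    then show ?thesis
      using emeasure_le_1[of "A k"] by (simp add: order_trans)
  next
    case False
    define x where "x = sqrt (real k * \<tau>)"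
    have x: "x > 0" "x\<^sup>2 = real k * \<tau>" using False \<tau> by (auto simp: x_def)
    have "A k \<subseteq> {\<omega> \<in> space M. W \<omega> \<ge> x} \<union> {\<omega> \<in> space M. - W \<omega> \<ge> x}"
    proof
      fix \<omega> assume "\<omega> \<in> A k"
      then have "x\<^sup>2 \<le> \<bar>W \<omega>\<bar>\<^sup>2" and sp: "\<omega> \<in> space M"
        using \<tau> x by (auto simp: A_def field_simps)
      then have "x \<le> \<bar>W \<omega>\<bar>" using x(1) abs_le_square_iff[of x "W \<omega>"] by simp
      then show "\<omega> \<in> {\<omega> \<in> space M. W \<omega> \<ge> x} \<union> {\<omega> \<in> space M. - W \<omega> \<ge> x}"
        using sp by auto
    qed
    then have "prob (A k) \<le> prob ({\<omega> \<in> space M. W \<omega> \<ge> x} \<union> {\<omega> \<in> space M. - W \<omega> \<ge> x})"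
      by (intro finite_measure_mono) auto
    also have "\<dots> \<le> prob {\<omega> \<in> space M. W \<omega> \<ge> x} + prob {\<omega> \<in> space M. - W \<omega> \<ge> x}"
      by (intro measure_Un_le) auto
    also have "\<dots> \<le> 2 * exp (- (x\<^sup>2 / (2 * \<tau>)))"
      using up[OF x(1)] lo[OF x(1)] by simp
    also have "exp (- (x\<^sup>2 / (2 * \<tau>))) = exp (- (1 / 2)) ^ k"
      using x \<tau> by (simp add: exp_of_nat_mult [symmetric])
    \<comment> \<open>\<open>exp (- 1 / 2) \<le> 2 / 3\<close> because \<open>exp (1 / 2) \<ge> 1 + 1 / 2\<close>.\<close>
    also have "\<dots> \<le> (2 / 3) ^ k"
      using exp_ge_add_one_self[of "1 / 2"]
      by (intro power_mono) (auto simp: exp_minus field_simps)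
    finally show ?thesis
      by (simp add: emeasure_eq_measure)
  qed
  have pt: "ennreal ((W \<omega>)\<^sup>2 / \<tau>) \<le> (\<Sum>k. indicator (A k) \<omega>)" if "\<omega> \<in> space M" for \<omega>
  proof -
    define y where "y = (W \<omega>)\<^sup>2 / \<tau>"
    have y: "y \<ge> 0" using \<tau> by (simp add: y_def)
    define m where "m = nat \<lfloor>y\<rfloor> + 1"
    have "y \<le> real m"
      using y unfolding m_def by linarith
    then have "ennreal y \<le> of_nat m"
      unfolding ennreal_of_nat_eq_real_of_nat by (rule ennreal_leI)
    also have "\<dots> = (\<Sum>k<m. indicator (A k) \<omega> :: ennreal)"
    proof -
      have "indicator (A k) \<omega> = (1 :: ennreal)" if "k < m" for k
      proof -
        have "real k \<le> y" using that y unfolding m_def by linarith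
        then show ?thesis using \<open>\<omega> \<in> space M\<close> by (simp add: A_def y_def)
      qed
      then show ?thesis by simp
    qed
    also have "\<dots> \<le> (\<Sum>k. indicator (A k) \<omega>)"
      by (intro sum_le_suminf) auto
    finally show ?thesis by (simp add: y_def)
  qed
  have "(\<integral>\<^sup>+\<omega>. ennreal ((W \<omega>)\<^sup>2 / \<tau>) \<partial>M) \<le> (\<integral>\<^sup>+\<omega>. (\<Sum>k. indicator (A k) \<omega>) \<partial>M)"
    by (intro nn_integral_mono pt)
  also have "\<dots> = (\<Sum>k. emeasure M (A k))"
    by (subst nn_integral_suminf) auto
  also have "\<dots> \<le> (\<Sum>k. ennreal (2 * (2 / 3) ^ k))"
    by (intro suminf_le PA) auto
  also have "\<dots> = ennreal (\<Sum>k. 2 * (2 / 3) ^ k)"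
    by (intro suminf_ennreal2 summable_mult summable_geometric) auto
  also have "(\<Sum>k. 2 * (2 / 3) ^ k :: real) = 6"
    by (subst suminf_mult) (auto simp: suminf_geometric)
  finally have *: "(\<integral>\<^sup>+\<omega>. ennreal ((W \<omega>)\<^sup>2 / \<tau>) \<partial>M) \<le> ennreal 6" .
  have int: "integrable M (\<lambda>\<omega>. (W \<omega>)\<^sup>2 / \<tau>)"
    using * \<tau> by (intro integrableI_bounded) (auto intro: le_less_trans)
  then have "integrable M (\<lambda>\<omega>. \<tau> * ((W \<omega>)\<^sup>2 / \<tau>))"
    by (rule integrable_mult_right)
  then show "integrable M (\<lambda>\<omega>. (W \<omega>)\<^sup>2)"
    using \<tau> by simp
  have "ennreal (expectation (\<lambda>\<omega>. (W \<omega>)\<^sup>2 / \<tau>)) \<le> ennreal 6"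
    using * int \<tau> by (subst nn_integral_eq_integral [symmetric]) auto
  then have "expectation (\<lambda>\<omega>. (W \<omega>)\<^sup>2 / \<tau>) \<le> 6"
    by (subst (asm) ennreal_le_iff) auto
  then show "expectation (\<lambda>\<omega>. (W \<omega>)\<^sup>2) \<le> 6 * \<tau>"
    using \<tau> by (simp add: field_simps)
qed

section \<open>Rank vectors at a given distance\<close>

text \<open>The squared Euclidean distance of two vectors indexed by \<open>{1..n}\<close>.\<close>
definition sq_dist :: "nat \<Rightarrow> (nat \<Rightarrow> nat) \<Rightarrow> (nat \<Rightarrow> nat) \<Rightarrow> real" where
  "sq_dist n r r' = (\<Sum>i=1..n. (real (r' i) - real (r i))\<^sup>2)"

lemma sq_dist_nonneg: "sq_dist n r r' \<ge> 0"
  by (simp add: sq_dist_def sum_nonneg)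

lemma sq_dist_self [simp]: "sq_dist n r r = 0"
  by (simp add: sq_dist_def)

lemma one_le_sq_of_nat_diff: "a \<noteq> b \<Longrightarrow> 1 \<le> (real a - real b)\<^sup>2"
proof -
  assume "a \<noteq> b"
  then have "1 \<le> \<bar>real a - real b\<bar>" by (cases "a < b") auto
  then show ?thesis using power_mono[of 1 "\<bar>real a - real b\<bar>" 2] by simp
qed

lemma finite_rank_space: "finite (rank_space n c)"
  by (rule finite_subset[of _ "{1..n} \<rightarrow>\<^sub>E {1..n}"]) (auto simp: rank_space_def intro: finite_PiE)

lemma rank_space_range: "r \<in> rank_space n c \<Longrightarrow> i \<in> {1..n} \<Longrightarrow> r i \<in> {1..n}"
  by (auto simp: rank_space_def)

lemma rank_space_nonempty: "0 \<le> c \<Longrightarrow> rank_space n c \<noteq> {}"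
proof -
  assume "0 \<le> c"
  then have "restrict (\<lambda>i. i) {1..n} \<in> rank_space n c"
    by (auto simp: rank_space_def)
  then show ?thesis by blast
qed

lemma one_le_sq_dist:
  assumes "r \<in> rank_space n c" "r' \<in> rank_space n c" "r' \<noteq> r"
  shows "1 \<le> sq_dist n r r'"
proof -
  obtain i where i: "i \<in> {1..n}" "r' i \<noteq> r i"
    using assms by (metis (no_types, lifting) PiE_ext mem_Collect_eq rank_space_def)
  have "1 \<le> (real (r' i) - real (r i))\<^sup>2" by (rule one_le_sq_of_nat_diff[OF i(2)])
  also have "\<dots> \<le> sq_dist n r r'"
    unfolding sq_dist_def using i by (intro member_le_sum) auto
  finally show ?thesis .
qed

text \<open>The ratio \<open>exp (- t)\<close> is at most \<open>4 / 5\<close>, whence the factor \<open>5 = 1 / (1 - 4 / 5)\<close>.\<close>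
lemma sum_geometric_tail_le:
  fixes t :: real
  assumes t: "1 / 4 \<le> t"
  shows "(\<Sum>m=1..n. exp (- t * real m)) \<le> 5 * exp (- t)"
proof -
  define x where "x = exp (- t)"
  have "exp (1 / 4 :: real) \<ge> 5 / 4" using exp_ge_add_one_self[of "1 / 4"] by simp
  then have "exp (- (1 / 4) :: real) \<le> 4 / 5" by (simp add: exp_minus field_simps)
  moreover have "x \<le> exp (- (1 / 4))" using t by (simp add: x_def)
  ultimately have "x \<le> 4 / 5" by linarith
  moreover have "0 < x" by (simp add: x_def)
  ultimately have x: "0 < x" "x \<le> 4 / 5" by auto
  have "(\<Sum>m=1..n. exp (- t * real m)) = (\<Sum>m=1..n. x ^ m)"
    by (intro sum.cong) (auto simp: x_def exp_of_nat_mult [symmetric] mult_ac)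
  also have "\<dots> = (\<Sum>m<n. x * x ^ m)"
    by (rule sum.reindex_bij_witness[where i = Suc and j = "\<lambda>m. m - 1"]) (auto simp: power_eq_if)
  also have "\<dots> = x * ((1 - x ^ n) / (1 - x))"
    using x by (simp add: sum_distrib_left [symmetric] sum_gp_strict)
  also have "\<dots> \<le> x * 5"
  proof (intro mult_left_mono)
    have "0 \<le> (4 - 5 * x) + x ^ n"
      using x by (intro add_nonneg_nonneg) auto
    then have "1 - x ^ n \<le> 5 * (1 - x)"
      by (simp add: algebra_simps)
    then show "(1 - x ^ n) / (1 - x) \<le> 5"
      using x by (simp add: pos_divide_le_eq)
  qed (use x in simp)
  finally show ?thesis by (simp add: x_def)
qed

lemma sum_gauss_le:
  fixes t :: real
  assumes t: "1 / 4 \<le> t" and a: "a \<in> {1..n}"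
  shows "(\<Sum>k=1..n. exp (- t * (real k - real a)\<^sup>2)) \<le> 1 + 10 * exp (- t)"
proof -
  let ?f = "\<lambda>k. exp (- t * (real k - real a)\<^sup>2)"
  have le: "?f k \<le> exp (- t * real m)" if "\<bar>real k - real a\<bar> = real m" for k m
  proof -
    have "real m \<le> real m ^ 2" by (cases m) (auto simp: power2_eq_square)
    also have "\<dots> = (real k - real a)\<^sup>2" using that by (metis power2_abs)
    finally show ?thesis using t by simp
  qed
  have "{1..n} = insert a ({1..<a} \<union> {a<..n})" using a by auto
  moreover have "{1..<a} \<inter> {a<..n} = {}" by auto
  ultimately have "(\<Sum>k=1..n. ?f k) = ?f a + ((\<Sum>k\<in>{1..<a}. ?f k) + (\<Sum>k\<in>{a<..n}. ?f k))"
    using sum.union_disjoint[of "{1..<a}" "{a<..n}" ?f] by auto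
  also have "(\<Sum>k\<in>{1..<a}. ?f k) = (\<Sum>m=1..a-1. ?f (a - m))"
    by (rule sum.reindex_bij_witness[where i = "\<lambda>m. a - m" and j = "\<lambda>k. a - k"]) auto
  also have "\<dots> \<le> (\<Sum>m=1..a-1. exp (- t * real m))"
    by (intro sum_mono le) (auto simp: of_nat_diff)
  also have "\<dots> \<le> 5 * exp (- t)" by (rule sum_geometric_tail_le[OF t])
  also have "(\<Sum>k\<in>{a<..n}. ?f k) = (\<Sum>m=1..n-a. ?f (a + m))"
    by (rule sum.reindex_bij_witness[where i = "\<lambda>m. a + m" and j = "\<lambda>k. k - a"]) auto
  also have "\<dots> \<le> (\<Sum>m=1..n-a. exp (- t * real m))"
    by (intro sum_mono le) auto
  also have "\<dots> \<le> 5 * exp (- t)" by (rule sum_geometric_tail_le[OF t])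
  finally show ?thesis by simp
qed

text \<open>
  The sum constraint of the rank space is dropped, so that the sum over \<open>[n]^n\<close> becomes a product of
  one-dimensional sums.
\<close>
lemma sum_rank_space_exp_le:
  fixes t :: real
  assumes t: "1 / 4 \<le> t" and r: "r \<in> rank_space n c"
  shows "(\<Sum>r'\<in>rank_space n c. exp (- t * sq_dist n r r')) \<le> exp (10 * real n * exp (- t))"
proof -
  have "(\<Sum>r'\<in>rank_space n c. exp (- t * sq_dist n r r'))
      \<le> (\<Sum>r'\<in>{1..n} \<rightarrow>\<^sub>E {1..n}. exp (- t * sq_dist n r r'))"
    by (intro sum_mono2 finite_PiE) (auto simp: rank_space_def)
  also have "\<dots> = (\<Sum>r'\<in>{1..n} \<rightarrow>\<^sub>E {1..n}. \<Prod>i\<in>{1..n}. exp (- t * (real (r' i) - real (r i))\<^sup>2))"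
    by (simp add: sq_dist_def sum_distrib_left exp_sum flip: sum_negf)
  also have "\<dots> = (\<Prod>i\<in>{1..n}. \<Sum>k\<in>{1..n}. exp (- t * (real k - real (r i))\<^sup>2))"
    by (rule prod_sum_PiE [symmetric]) auto
  also have "\<dots> \<le> (\<Prod>i\<in>{1..n}. exp (10 * exp (- t)))"
  proof (intro prod_mono conjI sum_nonneg)
    fix i assume "i \<in> {1..n}"
    then have "(\<Sum>k\<in>{1..n}. exp (- t * (real k - real (r i))\<^sup>2)) \<le> 1 + 10 * exp (- t)"
      by (intro sum_gauss_le t rank_space_range[OF r])
    also have "\<dots> \<le> exp (10 * exp (- t))" by (rule exp_ge_add_one_self)
    finally show "(\<Sum>k\<in>{1..n}. exp (- t * (real k - real (r i))\<^sup>2)) \<le> exp (10 * exp (- t))" .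
  qed auto
  also have "\<dots> = exp (10 * real n * exp (- t))"
    by (simp add: exp_of_nat_mult [symmetric] mult_ac)
  finally show ?thesis .
qed

section \<open>The least squares estimator for a fixed sample size\<close>

text \<open>
  One sample size \<open>n\<close> and one true rank vector \<open>r\<close>. The parameter \<open>e\<close> is the value at \<open>n\<close> of the sequence
  in (D2), so that \<open>e\<close> need not be small here.
\<close>
locale rank_estimation = prob_space M for M :: "'a measure" +
  fixes n :: nat and c \<sigma> \<beta> e :: real and \<theta> :: "nat \<Rightarrow> real" and r :: "nat \<Rightarrow> nat"
    and X Z :: "nat \<Rightarrow> nat \<Rightarrow> 'a \<Rightarrow> real" and rhat :: "'a \<Rightarrow> nat \<Rightarrow> nat"
  assumes n_ge: "1 \<le> n" and \<sigma>_pos: "0 < \<sigma>" and r: "r \<in> rank_space n c"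
    and model: "differential_comparison_model M n \<theta> r X Z"
    and noise: "noise_condition M n Z \<sigma>"
    and separated: "cond_D1 n c \<theta> \<beta>"
    and balanced: "\<And>r'. r' \<in> rank_space n c \<Longrightarrow>
          \<bar>(\<Sum>i=1..n. \<theta> (r' i)) - (\<Sum>i=1..n. \<theta> i)\<bar> \<le> e * sqrt (real n) * \<bar>\<beta>\<bar>"
    and rhat_meas: "rhat \<in> measurable M (count_space (rank_space n c))"
    and rhat_argmin: "\<And>\<omega>. \<omega> \<in> space M \<Longrightarrow>
          is_rank_estimate n c \<theta> (\<lambda>i j. X i j \<omega>) (rhat \<omega>)"
begin

text \<open>The noise part of the scores, and the squared distance to the true rank vector.\<close>
abbreviation "\<zeta> i \<omega> \<equiv> noise_score n (\<lambda>i j. Z i j \<omega>) i"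

abbreviation "D \<equiv> sq_dist n r"

lemma Z_meas: "(i, j) \<in> off_diag n \<Longrightarrow> Z i j \<in> borel_measurable M"
  using model by (auto simp: differential_comparison_model_def)

lemma \<zeta>_meas [measurable]: "i \<in> {1..n} \<Longrightarrow> \<zeta> i \<in> borel_measurable M"
  unfolding noise_score_def using Z_meas
  by (intro borel_measurable_times borel_measurable_sum borel_measurable_diff) (auto simp: off_diag_def)

lemma score_eq:
  assumes \<omega>: "\<omega> \<in> space M" and i: "i \<in> {1..n}"
  shows "score n \<theta> (\<lambda>i j. X i j \<omega>) i
       = \<theta> (r i) + ((\<Sum>j=1..n. \<theta> j) - (\<Sum>j=1..n. \<theta> (r j))) / real n + \<zeta> i \<omega>"
proof -
  have "(\<Sum>j\<in>{1..n} - {i}. X i j \<omega> - X j i \<omega>)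
      = (\<Sum>j\<in>{1..n} - {i}. 2 * (\<theta> (r i) - \<theta> (r j)) + (Z i j \<omega> - Z j i \<omega>))"
    using model \<omega> i by (intro sum.cong) (auto simp: differential_comparison_model_def off_diag_def)
  also have "\<dots> = (\<Sum>j\<in>{1..n} - {i}. 2 * (\<theta> (r i) - \<theta> (r j)))
      + (\<Sum>j\<in>{1..n} - {i}. Z i j \<omega> - Z j i \<omega>)"
    by (rule sum.distrib)
  also have "(\<Sum>j\<in>{1..n} - {i}. 2 * (\<theta> (r i) - \<theta> (r j))) = (\<Sum>j=1..n. 2 * (\<theta> (r i) - \<theta> (r j)))"
    by (rule sum.mono_neutral_left) auto
  also have "\<dots> = 2 * real n * \<theta> (r i) - 2 * (\<Sum>j=1..n. \<theta> (r j))"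
    by (simp add: sum_subtractf sum_distrib_left [symmetric])
  finally show ?thesis
    using n_ge by (simp add: score_def noise_score_def field_simps)
qed

lemma rhat_in: "\<omega> \<in> space M \<Longrightarrow> rhat \<omega> \<in> rank_space n c"
  using rhat_argmin by (auto simp: is_rank_estimate_def is_arg_min_def)

lemma rhat_event [measurable]: "{\<omega> \<in> space M. rhat \<omega> = r'} \<in> sets M"
proof (cases "r' \<in> rank_space n c")
  case True
  then have "rhat -` {r'} \<inter> space M \<in> sets M"
    by (intro measurable_sets[OF rhat_meas]) auto
  moreover have "rhat -` {r'} \<inter> space M = {\<omega> \<in> space M. rhat \<omega> = r'}" by auto
  ultimately show ?thesis by simp
next
  case False
  then have "{\<omega> \<in> space M. rhat \<omega> = r'} = {}" using rhat_in by auto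
  then show ?thesis by (simp only: sets.empty_sets)
qed

lemma
  fixes f :: "(nat \<Rightarrow> nat) \<Rightarrow> real"
  shows integrable_rhat: "integrable M (\<lambda>\<omega>. f (rhat \<omega>))"
    and expectation_rhat: "expectation (\<lambda>\<omega>. f (rhat \<omega>))
           = (\<Sum>r'\<in>rank_space n c. f r' * prob {\<omega> \<in> space M. rhat \<omega> = r'})"
proof -
  let ?g = "\<lambda>\<omega>. \<Sum>r'\<in>rank_space n c. f r' * indicator {\<omega> \<in> space M. rhat \<omega> = r'} \<omega>"
  have eq: "f (rhat \<omega>) = ?g \<omega>" if "\<omega> \<in> space M" for \<omega>
  proof -
    have "?g \<omega> = (\<Sum>r'\<in>rank_space n c. if r' = rhat \<omega> then f r' else 0)"
      using that by (intro sum.cong) auto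
    then show ?thesis
      using rhat_in[OF that] finite_rank_space by simp
  qed
  have int: "integrable M (\<lambda>\<omega>. f r' * indicator {\<omega> \<in> space M. rhat \<omega> = r'} \<omega>)" for r'
    by (intro integrable_mult_right integrable_real_indicator) (auto simp: emeasure_eq_measure)
  then have "integrable M ?g" by (intro Bochner_Integration.integrable_sum)
  then show "integrable M (\<lambda>\<omega>. f (rhat \<omega>))"
    by (subst Bochner_Integration.integrable_cong[OF refl eq]) auto
  have "expectation (\<lambda>\<omega>. f (rhat \<omega>)) = expectation ?g"
    by (intro Bochner_Integration.integral_cong refl eq)
  also have "\<dots> = (\<Sum>r'\<in>rank_space n c. f r' * prob {\<omega> \<in> space M. rhat \<omega> = r'})"
    using int by (subst Bochner_Integration.integral_sum) auto
  finally show "expectation (\<lambda>\<omega>. f (rhat \<omega>))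
           = (\<Sum>r'\<in>rank_space n c. f r' * prob {\<omega> \<in> space M. rhat \<omega> = r'})" .
qed

lemma expectation_rhat_mono:
  assumes "\<And>r'. r' \<in> rank_space n c \<Longrightarrow> f r' \<le> g r'"
  shows "expectation (\<lambda>\<omega>. f (rhat \<omega>)) \<le> expectation (\<lambda>\<omega>. g (rhat \<omega>) :: real)"
  unfolding expectation_rhat using assms by (intro sum_mono mult_right_mono) auto

text \<open>
  Optimality of the estimate against the truth. The common shift \<open>\<delta>\<close> of the scores is paired with
  \<open>\<Sum>i. d i\<close> only, and (D2) controls both factors.
\<close>
lemma basic_inequality:
  assumes \<omega>: "\<omega> \<in> space M"
  shows "(\<Sum>i=1..n. (\<theta> (rhat \<omega> i) - \<theta> (r i))\<^sup>2)
       \<le> 2 * (\<Sum>i=1..n. (\<theta> (rhat \<omega> i) - \<theta> (r i)) * \<zeta> i \<omega>) + 4 * e\<^sup>2 * \<beta>\<^sup>2"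
proof -
  define d where "d i = \<theta> (rhat \<omega> i) - \<theta> (r i)" for i
  define a where "a = (\<Sum>j=1..n. \<theta> (r j)) - (\<Sum>j=1..n. \<theta> j)"
  define b where "b = (\<Sum>j=1..n. \<theta> (rhat \<omega> j)) - (\<Sum>j=1..n. \<theta> j)"
  define \<delta> where "\<delta> = - a / real n"
  let ?S = "score n \<theta> (\<lambda>i j. X i j \<omega>)"
  have S: "?S i = \<theta> (r i) + \<delta> + \<zeta> i \<omega>" if "i \<in> {1..n}" for i
    using score_eq[OF \<omega> that] by (simp add: \<delta>_def a_def)
  have "(\<Sum>i=1..n. (?S i - \<theta> (rhat \<omega> i))\<^sup>2) \<le> (\<Sum>i=1..n. (?S i - \<theta> (r i))\<^sup>2)"
    using rhat_argmin[OF \<omega>] r by (auto simp: is_rank_estimate_def is_arg_min_def not_less)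
  moreover have "(\<Sum>i=1..n. (?S i - \<theta> (rhat \<omega> i))\<^sup>2)
      = (\<Sum>i=1..n. (?S i - \<theta> (r i))\<^sup>2 + (d i)\<^sup>2 - 2 * (d i * \<zeta> i \<omega>) - 2 * \<delta> * d i)"
    using S by (intro sum.cong) (auto simp: d_def power2_eq_square algebra_simps)
  ultimately have "(\<Sum>i=1..n. (d i)\<^sup>2) \<le> 2 * (\<Sum>i=1..n. d i * \<zeta> i \<omega>) + 2 * (\<delta> * (\<Sum>i=1..n. d i))"
    by (simp add: sum.distrib sum_subtractf sum_distrib_left mult_ac)
  moreover have "\<delta> * (\<Sum>i=1..n. d i) \<le> 2 * e\<^sup>2 * \<beta>\<^sup>2"
  proof -
    let ?m = "e * sqrt (real n) * \<bar>\<beta>\<bar>"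
    have a: "\<bar>a\<bar> \<le> ?m" and b: "\<bar>b\<bar> \<le> ?m"
      using balanced[OF r] balanced[OF rhat_in[OF \<omega>]] by (simp_all add: a_def b_def)
    then have "\<bar>a * a\<bar> \<le> ?m * ?m" "\<bar>a * b\<bar> \<le> ?m * ?m"
      unfolding abs_mult by (meson abs_ge_zero mult_mono order_trans)+
    then have "a * a - a * b \<le> 2 * (?m * ?m)" by linarith
    also have "?m * ?m = real n * (e\<^sup>2 * \<beta>\<^sup>2)"
      by (simp add: power2_eq_square [symmetric] power_mult_distrib)
    finally have "(a * a - a * b) / real n \<le> 2 * (real n * (e\<^sup>2 * \<beta>\<^sup>2)) / real n"
      by (intro divide_right_mono) auto
    moreover have "(\<Sum>i=1..n. d i) = b - a"
      by (simp add: d_def a_def b_def sum_subtractf)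
    moreover have "\<delta> * (b - a) = (a * a - a * b) / real n"
      by (simp add: \<delta>_def right_diff_distrib diff_divide_distrib)
    ultimately show ?thesis
      using n_ge by simp
  qed
  ultimately show ?thesis by (simp add: d_def)
qed

lemma separation:
  "r' \<in> rank_space n c \<Longrightarrow> \<beta>\<^sup>2 * D r' \<le> (\<Sum>i=1..n. (\<theta> (r' i) - \<theta> (r i))\<^sup>2)"
  using separated r unfolding cond_D1_def sq_dist_def
  by (metis (no_types, lifting) power2_commute sum.cong)

text \<open>
  For \<open>r' \<noteq> r\<close> integrality gives \<open>D r' \<ge> 1\<close>, hence \<open>\<beta>\<^sup>2 \<le> \<Sum>i. (d i)\<^sup>2\<close>, and the remainder of the basic
  inequality is absorbed into its left-hand side.
\<close>
lemma prob_rhat_eq_le: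
  assumes r': "r' \<in> rank_space n c" and e: "4 * e\<^sup>2 < 1"
  shows "prob {\<omega> \<in> space M. rhat \<omega> = r'} \<le> exp (- ((1 - 4 * e\<^sup>2)\<^sup>2 * signal n \<beta> \<sigma> * D r'))"
proof (cases "r' = r \<or> \<beta> = 0")
  case False
  define d where "d i = \<theta> (r' i) - \<theta> (r i)" for i
  define Q where "Q = (\<Sum>i=1..n. (d i)\<^sup>2)"
  define \<kappa> where "\<kappa> = 1 - 4 * e\<^sup>2"
  have \<kappa>: "0 < \<kappa>" using e by (simp add: \<kappa>_def)
  have DQ: "\<beta>\<^sup>2 * D r' \<le> Q" using separation[OF r'] by (simp add: Q_def d_def)
  moreover have "1 \<le> D r'" using False r r' by (intro one_le_sq_dist) auto
  then have "\<beta>\<^sup>2 \<le> \<beta>\<^sup>2 * D r'" by (simp add: mult_le_cancel_left1)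
  ultimately have \<beta>Q: "\<beta>\<^sup>2 \<le> Q" by simp
  then have Q: "0 < Q" using False by (meson less_le_trans zero_less_power2)
  have "\<kappa> * Q / 2 \<le> (\<Sum>i=1..n. d i * \<zeta> i \<omega>)" if "\<omega> \<in> space M" "rhat \<omega> = r'" for \<omega>
  proof -
    have "Q \<le> 2 * (\<Sum>i=1..n. d i * \<zeta> i \<omega>) + 4 * e\<^sup>2 * \<beta>\<^sup>2"
      using basic_inequality[OF that(1)] by (simp add: that(2) Q_def d_def)
    moreover have "4 * e\<^sup>2 * \<beta>\<^sup>2 \<le> 4 * e\<^sup>2 * Q" using \<beta>Q by (intro mult_left_mono) auto
    moreover have "\<kappa> * Q = Q - 4 * e\<^sup>2 * Q" by (simp add: \<kappa>_def left_diff_distrib)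
    ultimately show ?thesis by linarith
  qed
  then have "prob {\<omega> \<in> space M. rhat \<omega> = r'}
      \<le> prob {\<omega> \<in> space M. (\<Sum>i=1..n. d i * \<zeta> i \<omega>) \<ge> \<kappa> * Q / 2}"
    by (intro finite_measure_mono) auto
  also have "\<dots> \<le> exp (- (real n * (\<kappa> * Q / 2)\<^sup>2 / (\<sigma>\<^sup>2 * (\<Sum>i=1..n. (d i)\<^sup>2))))"
    using \<kappa> Q by (intro noise_score_tail prob_space_axioms noise Z_meas \<sigma>_pos) auto
  also have "real n * (\<kappa> * Q / 2)\<^sup>2 / (\<sigma>\<^sup>2 * (\<Sum>i=1..n. (d i)\<^sup>2)) = \<kappa>\<^sup>2 * (real n / (4 * \<sigma>\<^sup>2)) * Q"
    using Q \<sigma>_pos unfolding Q_def [symmetric] by (simp add: power2_eq_square field_simps)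
  also have "exp (- (\<kappa>\<^sup>2 * (real n / (4 * \<sigma>\<^sup>2)) * Q)) \<le> exp (- (\<kappa>\<^sup>2 * (real n / (4 * \<sigma>\<^sup>2)) * (\<beta>\<^sup>2 * D r')))"
    using DQ by (intro exp_le_cancel_iff[THEN iffD2] le_imp_neg_le mult_left_mono) auto
  also have "\<kappa>\<^sup>2 * (real n / (4 * \<sigma>\<^sup>2)) * (\<beta>\<^sup>2 * D r') = \<kappa>\<^sup>2 * signal n \<beta> \<sigma> * D r'"
    by (simp add: signal_def)
  finally show ?thesis by (simp add: \<kappa>_def)
qed (auto simp: signal_def)

text \<open>
  The union bound is applied to the exponential moment of \<open>D rhat / 2\<close>. Passing to the expectation
  through the tangent line \<open>x / 2 \<le> exp (x / 2 - b) + b - 1\<close> then costs a constant factor only.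
\<close>
lemma expected_sq_dist_exp_le:
  assumes e: "4 * e\<^sup>2 < 1" and s: "3 / 4 \<le> (1 - 4 * e\<^sup>2)\<^sup>2 * signal n \<beta> \<sigma>"
  shows "expectation (\<lambda>\<omega>. D (rhat \<omega>)) \<le> 40 * real n * exp (- ((1 - 4 * e\<^sup>2)\<^sup>2 * signal n \<beta> \<sigma>))"
proof -
  define s where "s = (1 - 4 * e\<^sup>2)\<^sup>2 * signal n \<beta> \<sigma>"
  define t where "t = s - 1 / 2"
  have t: "1 / 4 \<le> t" using s by (simp add: t_def s_def)
  define b where "b = 10 * real n * exp (- t)"
  have "expectation (\<lambda>\<omega>. exp (D (rhat \<omega>) / 2))
      = (\<Sum>r'\<in>rank_space n c. exp (D r' / 2) * prob {\<omega> \<in> space M. rhat \<omega> = r'})"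
    by (rule expectation_rhat)
  also have "\<dots> \<le> (\<Sum>r'\<in>rank_space n c. exp (D r' / 2) * exp (- (s * D r')))"
    using prob_rhat_eq_le[OF _ e] by (intro sum_mono mult_left_mono) (auto simp: s_def)
  also have "\<dots> = (\<Sum>r'\<in>rank_space n c. exp (- t * D r'))"
    by (simp add: t_def exp_add [symmetric] algebra_simps)
  also have "\<dots> \<le> exp b"
    unfolding b_def by (rule sum_rank_space_exp_le[OF t r])
  finally have E: "expectation (\<lambda>\<omega>. exp (D (rhat \<omega>) / 2)) \<le> exp b" .
  have "expectation (\<lambda>\<omega>. D (rhat \<omega>)) \<le> expectation (\<lambda>\<omega>. 2 * (exp (- b) * exp (D (rhat \<omega>) / 2) + (b - 1)))"
  proof (intro integral_mono)
    fix \<omega>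
    show "D (rhat \<omega>) \<le> 2 * (exp (- b) * exp (D (rhat \<omega>) / 2) + (b - 1))"
      using exp_ge_add_one_self[of "D (rhat \<omega>) / 2 - b"]
      unfolding exp_add [symmetric] by (simp del: exp_ge_add_one_self add: add.commute)
  qed (rule integrable_rhat)+
  also have "\<dots> = 2 * (exp (- b) * expectation (\<lambda>\<omega>. exp (D (rhat \<omega>) / 2)) + (b - 1))"
    using integrable_rhat[of "\<lambda>r'. exp (D r' / 2)"] by (simp add: prob_space)
  also have "\<dots> \<le> 2 * (exp (- b) * exp b + (b - 1))"
    using E by (intro mult_left_mono add_right_mono) auto
  also have "\<dots> = 20 * real n * (exp (1 / 2) * exp (- s))"
    by (simp add: exp_minus_inverse mult.commute[of "exp (- b)"] b_def t_def exp_add [symmetric] algebra_simps)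
  also have "\<dots> \<le> 20 * real n * (2 * exp (- s))"
  proof -
    have "(exp (1 / 2 :: real))\<^sup>2 = exp 1" by (simp add: power2_eq_square exp_add [symmetric])
    also have "\<dots> \<le> 2\<^sup>2" using exp_le by simp
    finally have "exp (1 / 2 :: real) \<le> 2" by (rule power2_le_imp_le) simp
    then show ?thesis by (intro mult_left_mono mult_right_mono) auto
  qed
  finally show ?thesis by (simp add: s_def)
qed

lemma second_moment_noise_score:
  assumes i: "i \<in> {1..n}"
  shows "integrable M (\<lambda>\<omega>. (\<zeta> i \<omega>)\<^sup>2)" "expectation (\<lambda>\<omega>. (\<zeta> i \<omega>)\<^sup>2) \<le> 3 * \<sigma>\<^sup>2 / real n"
proof -
  define \<tau> where "\<tau> = \<sigma>\<^sup>2 / (2 * real n)"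
  have \<tau>: "0 < \<tau>" using \<sigma>_pos n_ge by (simp add: \<tau>_def)
  \<comment> \<open>The values \<open>u = 1\<close> and \<open>u = - 1\<close> give the two tails of \<open>\<zeta> i\<close>.\<close>
  have tail: "prob {\<omega> \<in> space M. u * \<zeta> i \<omega> \<ge> x} \<le> exp (- (x\<^sup>2 / (2 * \<tau>)))"
    if "0 < x" "u\<^sup>2 = 1" for x u :: real
  proof -
    have "(\<Sum>k=1..n. (if k = i then u else 0) * \<zeta> k \<omega>) = u * \<zeta> i \<omega>" for \<omega>
      using i by (simp add: if_distrib[of "\<lambda>x. x * _"] cong: if_cong)
    moreover have "(\<Sum>k=1..n. (if k = i then u else 0)\<^sup>2) = 1"
      using i that by (simp add: if_distrib[of "\<lambda>x. x\<^sup>2"] cong: if_cong)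
    ultimately show ?thesis
      using noise_score_tail[OF prob_space_axioms noise Z_meas \<sigma>_pos \<open>0 < x\<close>,
          of "\<lambda>k. if k = i then u else 0"]
      by (simp add: \<tau>_def mult_ac)
  qed
  have m: "\<zeta> i \<in> borel_measurable M" using i by (rule \<zeta>_meas)
  note second_moment_subgaussian[OF m \<tau>]
  from this[OF tail[of _ 1, simplified] tail[of _ "-1", simplified]]
  show "integrable M (\<lambda>\<omega>. (\<zeta> i \<omega>)\<^sup>2)" "expectation (\<lambda>\<omega>. (\<zeta> i \<omega>)\<^sup>2) \<le> 3 * \<sigma>\<^sup>2 / real n"
    by (simp_all add: \<tau>_def)
qed

text \<open>
  A bound valid for every positive signal: the estimate is only compared with the noise as a whole, so
  no entropy term appears.
\<close>
lemma expected_sq_dist_le: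
  assumes \<beta>: "\<beta> \<noteq> 0"
  shows "expectation (\<lambda>\<omega>. D (rhat \<omega>)) \<le> 3 * real n / signal n \<beta> \<sigma> + 8 * e\<^sup>2"
proof -
  have pt: "D (rhat \<omega>) \<le> 4 / \<beta>\<^sup>2 * (\<Sum>i=1..n. (\<zeta> i \<omega>)\<^sup>2) + 8 * e\<^sup>2" if \<omega>: "\<omega> \<in> space M" for \<omega>
  proof -
    define d where "d i = \<theta> (rhat \<omega> i) - \<theta> (r i)" for i
    define Q where "Q = (\<Sum>i=1..n. (d i)\<^sup>2)"
    have "2 * (\<Sum>i=1..n. d i * \<zeta> i \<omega>) \<le> (\<Sum>i=1..n. (d i)\<^sup>2 / 2 + 2 * (\<zeta> i \<omega>)\<^sup>2)"
      unfolding sum_distrib_left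
    proof (rule sum_mono)
      fix i
      show "2 * (d i * \<zeta> i \<omega>) \<le> (d i)\<^sup>2 / 2 + 2 * (\<zeta> i \<omega>)\<^sup>2"
        using zero_le_power2[of "d i - 2 * \<zeta> i \<omega>"] by (simp add: power2_eq_square algebra_simps)
    qed
    also have "\<dots> = Q / 2 + 2 * (\<Sum>i=1..n. (\<zeta> i \<omega>)\<^sup>2)"
      by (simp add: Q_def sum.distrib sum_distrib_left sum_divide_distrib)
    finally have "Q \<le> 4 * (\<Sum>i=1..n. (\<zeta> i \<omega>)\<^sup>2) + 8 * e\<^sup>2 * \<beta>\<^sup>2"
      using basic_inequality[OF \<omega>] by (simp add: Q_def d_def)
    moreover have "\<beta>\<^sup>2 * D (rhat \<omega>) \<le> Q"
      using separation[OF rhat_in[OF \<omega>]] by (simp add: Q_def d_def)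
    ultimately have "\<beta>\<^sup>2 * D (rhat \<omega>) \<le> \<beta>\<^sup>2 * (4 / \<beta>\<^sup>2 * (\<Sum>i=1..n. (\<zeta> i \<omega>)\<^sup>2) + 8 * e\<^sup>2)"
      using \<beta> by (simp add: algebra_simps)
    then show ?thesis using \<beta> by (simp add: mult_le_cancel_left)
  qed
  have int: "integrable M (\<lambda>\<omega>. \<Sum>i=1..n. (\<zeta> i \<omega>)\<^sup>2)"
    by (intro Bochner_Integration.integrable_sum second_moment_noise_score)
  have "expectation (\<lambda>\<omega>. D (rhat \<omega>))
      \<le> expectation (\<lambda>\<omega>. 4 / \<beta>\<^sup>2 * (\<Sum>i=1..n. (\<zeta> i \<omega>)\<^sup>2) + 8 * e\<^sup>2)"
    using int pt by (intro integral_mono integrable_rhat) auto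
  also have "\<dots> = 4 / \<beta>\<^sup>2 * (\<Sum>i=1..n. expectation (\<lambda>\<omega>. (\<zeta> i \<omega>)\<^sup>2)) + 8 * e\<^sup>2"
    using int second_moment_noise_score(1) by (simp add: prob_space Bochner_Integration.integral_sum)
  also have "\<dots> \<le> 4 / \<beta>\<^sup>2 * (\<Sum>i=1..n. 3 * \<sigma>\<^sup>2 / real n) + 8 * e\<^sup>2"
    by (intro add_right_mono mult_left_mono sum_mono second_moment_noise_score) auto
  also have "\<dots> = 3 * real n / signal n \<beta> \<sigma> + 8 * e\<^sup>2"
    using n_ge \<beta> \<sigma>_pos by (simp add: signal_def field_simps)
  finally show ?thesis .
qed

end

section \<open>From the squared distance to the loss\<close>

lemma rank_loss_le_sq_dist:
  assumes q: "0 \<le> q" "q \<le> 2"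
  shows "rank_loss q n r' r \<le> sq_dist n r r' / real n"
proof -
  have "(if q = 0 then of_bool (a \<noteq> b) else \<bar>real a - real b\<bar> powr q) \<le> (real a - real b)\<^sup>2" for a b :: nat
  proof (cases "a = b")
    case False
    then have 1: "1 \<le> \<bar>real a - real b\<bar>" by (cases "a < b") auto
    then have "\<bar>real a - real b\<bar> powr q \<le> \<bar>real a - real b\<bar> powr 2"
      using q by (intro powr_mono) auto
    also have "\<dots> = (real a - real b)\<^sup>2" using False by simp
    finally show ?thesis using one_le_sq_of_nat_diff[OF False] by simp
  qed auto
  then show ?thesis
    unfolding rank_loss_def sq_dist_def by (simp add: divide_right_mono sum_mono)
qed

lemma rank_loss_le_powr:
  assumes q: "0 \<le> q" and n: "1 \<le> n" and r: "r \<in> rank_space n c" "r' \<in> rank_space n c"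
  shows "rank_loss q n r' r \<le> real n powr q"
proof -
  have "(\<Sum>i=1..n. if q = 0 then of_bool (r' i \<noteq> r i) else \<bar>real (r' i) - real (r i)\<bar> powr q)
      \<le> (\<Sum>i=1..n. real n powr q)"
  proof (rule sum_mono)
    fix i assume i: "i \<in> {1..n}"
    have "\<bar>real (r' i) - real (r i)\<bar> \<le> real n"
      using rank_space_range[OF r(1) i] rank_space_range[OF r(2) i] by auto
    then show "(if q = 0 then of_bool (r' i \<noteq> r i) else \<bar>real (r' i) - real (r i)\<bar> powr q) \<le> real n powr q"
      using n q by (auto intro: powr_mono2)
  qed
  then show ?thesis
    using n unfolding rank_loss_def by (simp add: divide_simps mult.commute)
qed

text \<open>With \<open>y = s x\<^sup>2\<close> this is \<open>y powr (q / 2) \<le> 1 + y\<close>, which needs only \<open>0 < q / 2 \<le> 1\<close>.\<close>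
lemma powr_le_one_plus:
  fixes x s q :: real
  assumes q: "0 < q" "q \<le> 2" and s: "0 < s"
  shows "\<bar>x\<bar> powr q \<le> s powr (- q / 2) * (1 + s * x\<^sup>2)"
proof (cases "x = 0")
  case False
  define y where "y = s * x\<^sup>2"
  have y: "0 < y" using s False by (simp add: y_def)
  have "y powr (q / 2) \<le> 1 + y"
  proof (cases "y \<le> 1")
    case True
    then have "y powr (q / 2) \<le> 1" using y q by (intro powr_le1) auto
    then show ?thesis using y by simp
  next
    case False
    then have "y powr (q / 2) \<le> y powr 1" using q by (intro powr_mono) auto
    then show ?thesis using y by simp
  qed
  then have "s powr (- q / 2) * y powr (q / 2) \<le> s powr (- q / 2) * (1 + y)"
    by (intro mult_left_mono) auto
  moreover have "s powr (- q / 2) * y powr (q / 2) = \<bar>x\<bar> powr q"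
  proof -
    have "x\<^sup>2 = \<bar>x\<bar> powr 2" using False by simp
    then have "y powr (q / 2) = s powr (q / 2) * \<bar>x\<bar> powr q"
      using s by (simp only: y_def powr_mult powr_powr) simp
    then show ?thesis using s by (simp add: powr_add [symmetric] flip: mult.assoc)
  qed
  ultimately show ?thesis by (simp add: y_def)
qed (use s in auto)

lemma rank_loss_le_signal:
  assumes q: "0 \<le> q" "q \<le> 2" and s: "0 < s" and n: "1 \<le> n"
  shows "rank_loss q n r' r \<le> s powr (- q / 2) * (1 + s * sq_dist n r r' / real n)"
proof -
  have "(\<Sum>i=1..n. if q = 0 then of_bool (r' i \<noteq> r i) else \<bar>real (r' i) - real (r i)\<bar> powr q)
      \<le> (\<Sum>i=1..n. s powr (- q / 2) * (1 + s * (real (r' i) - real (r i))\<^sup>2))"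
  proof (rule sum_mono)
    fix i
    have "0 \<le> s * (real (r' i) - real (r i))\<^sup>2" using s by simp
    then show "(if q = 0 then of_bool (r' i \<noteq> r i) else \<bar>real (r' i) - real (r i)\<bar> powr q)
        \<le> s powr (- q / 2) * (1 + s * (real (r' i) - real (r i))\<^sup>2)"
      using q s powr_le_one_plus[of q s "real (r' i) - real (r i)"] by auto
  qed
  also have "\<dots> = s powr (- q / 2) * (real n + s * sq_dist n r r')"
    by (simp add: sq_dist_def sum_distrib_left [symmetric] sum.distrib)
  also have "\<dots> = real n * (s powr (- q / 2) * (1 + s * sq_dist n r r' / real n))"
    using n by (simp add: field_simps)
  finally show ?thesis
    using n unfolding rank_loss_def by (simp add: pos_divide_le_eq mult.commute)
qed

text \<open>
  The correction \<open>\<eta>\<close> to the exponent when (D2) holds with constant \<open>e\<close>. If \<open>e\<close> is not small, the value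
  \<open>- 1\<close> turns the exponential rate into the constant 1. The threshold \<open>32 e\<^sup>2 \<le> 1\<close> ensures
  \<open>(1 - 4 e\<^sup>2)\<^sup>2 \<ge> 3 / 4\<close>, as \<open>expected_sq_dist_exp_le\<close> needs for signals above 1.
\<close>
definition exponent_defect :: "real \<Rightarrow> real" where
  "exponent_defect e = (if 32 * e\<^sup>2 \<le> 1 then (1 - 4 * e\<^sup>2)\<^sup>2 - 1 else - 1)"

lemma three_quarters_le_exponent:
  fixes e :: real
  assumes "32 * e\<^sup>2 \<le> 1"
  shows "3 / 4 \<le> (1 - 4 * e\<^sup>2)\<^sup>2"
proof -
  have "(7 / 8)\<^sup>2 \<le> (1 - 4 * e\<^sup>2)\<^sup>2" using assms by (intro power_mono) auto
  then show ?thesis by (simp add: power2_eq_square)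
qed

lemma exponent_defect_tendsto_0:
  fixes e :: "nat \<Rightarrow> real"
  assumes "e \<longlonglongrightarrow> 0"
  shows "(\<lambda>n. exponent_defect (e n)) \<longlonglongrightarrow> 0"
    and "eventually (\<lambda>n. 32 * (e n)\<^sup>2 \<le> 1) sequentially"
proof -
  have "(\<lambda>n. 32 * (e n)\<^sup>2) \<longlonglongrightarrow> 32 * 0\<^sup>2"
    by (intro tendsto_intros assms)
  then have "eventually (\<lambda>n. 32 * (e n)\<^sup>2 < 1) sequentially"
    by (rule order_tendstoD) simp
  then show ev: "eventually (\<lambda>n. 32 * (e n)\<^sup>2 \<le> 1) sequentially"
    by eventually_elim simp
  have "(\<lambda>n. (1 - 4 * (e n)\<^sup>2)\<^sup>2 - 1) \<longlonglongrightarrow> (1 - 4 * 0\<^sup>2)\<^sup>2 - 1"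
    by (intro tendsto_intros assms)
  then have "(\<lambda>n. (1 - 4 * (e n)\<^sup>2)\<^sup>2 - 1) \<longlonglongrightarrow> 0" by simp
  then show "(\<lambda>n. exponent_defect (e n)) \<longlonglongrightarrow> 0"
    by (rule Lim_transform_eventually) (use ev in eventually_elim, simp add: exponent_defect_def)
qed

context rank_estimation
begin

lemma expected_sq_dist_exp_defect_le:
  assumes e: "32 * e\<^sup>2 \<le> 1" and s: "1 < signal n \<beta> \<sigma>"
  shows "expectation (\<lambda>\<omega>. D (rhat \<omega>))
      \<le> 40 * real n * exp (- (1 + exponent_defect e) * signal n \<beta> \<sigma>)"
proof -
  have "3 / 4 * 1 \<le> (1 - 4 * e\<^sup>2)\<^sup>2 * signal n \<beta> \<sigma>"
    using three_quarters_le_exponent[OF e] s by (intro mult_mono) auto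
  then show ?thesis
    using expected_sq_dist_exp_le e by (simp add: exponent_defect_def)
qed

lemma expected_loss_le_rate:
  assumes q: "0 \<le> q" "q \<le> 2" and B: "e\<^sup>2 \<le> B"
  shows "expectation (\<lambda>\<omega>. rank_loss q n (rhat \<omega>) r)
      \<le> (44 + 8 * B) * rate q n \<beta> \<sigma> (exponent_defect e)"
proof -
  let ?s = "signal n \<beta> \<sigma>"
  let ?L = "expectation (\<lambda>\<omega>. rank_loss q n (rhat \<omega>) r)"
  let ?D = "expectation (\<lambda>\<omega>. D (rhat \<omega>))"
  have B0: "0 \<le> B" by (rule order_trans[OF zero_le_power2 B])
  have "8 * e\<^sup>2 / real n \<le> 8 * e\<^sup>2 / 1"
    using n_ge by (intro divide_left_mono) auto
  then have eB: "8 * e\<^sup>2 / real n \<le> 8 * B"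
    using B by simp
  have L_sq: "?L \<le> ?D / real n"
  proof -
    have "?L \<le> expectation (\<lambda>\<omega>. D (rhat \<omega>) / real n)"
      by (intro expectation_rhat_mono rank_loss_le_sq_dist q)
    then show ?thesis by simp
  qed
  have L_n: "?L \<le> real n powr q"
  proof -
    have "?L \<le> expectation (\<lambda>\<omega>. real n powr q)"
      by (rule expectation_rhat_mono) (rule rank_loss_le_powr[OF q(1) n_ge r])
    then show ?thesis by (simp add: prob_space)
  qed
  have D_le: "?D / real n \<le> 3 / ?s + 8 * B" if "\<beta> \<noteq> 0"
  proof -
    have "?D / real n \<le> (3 * real n / ?s + 8 * e\<^sup>2) / real n"
      by (intro divide_right_mono expected_sq_dist_le that) auto
    also have "\<dots> = 3 / ?s + 8 * e\<^sup>2 / real n" using n_ge by (simp add: add_divide_distrib)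
    finally show ?thesis using eB by linarith
  qed
  consider "1 < ?s" "32 * e\<^sup>2 \<le> 1" | "1 < ?s" "\<not> 32 * e\<^sup>2 \<le> 1" | "?s \<le> 1" "\<beta> = 0" | "?s \<le> 1" "\<beta> \<noteq> 0"
    by linarith
  then show ?thesis
  proof cases
    case 1
    let ?E = "exp (- (1 + exponent_defect e) * ?s)"
    have "?D / real n \<le> 40 * real n * ?E / real n"
      by (intro divide_right_mono expected_sq_dist_exp_defect_le 1) auto
    also have "\<dots> = 40 * ?E" using n_ge by simp
    also have "\<dots> \<le> (44 + 8 * B) * ?E" using B0 by (intro mult_right_mono) auto
    finally show ?thesis using L_sq 1 by (simp add: rate_def)
  next
    case 2
    then have "\<beta> \<noteq> 0" by (auto simp: signal_def)
    then have "?D / real n \<le> 3 / ?s + 8 * B" by (rule D_le)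
    also have "3 / ?s \<le> 3" using 2 by (simp add: divide_simps)
    finally show ?thesis using L_sq 2 by (simp add: rate_def exponent_defect_def)
  next
    case 3
    have "1 * real n powr q \<le> (44 + 8 * B) * real n powr q" using B0 by (intro mult_right_mono) auto
    then show ?thesis using L_n 3 by (simp add: rate_def)
  next
    case 4
    let ?p = "?s powr (- q / 2)"
    have s: "0 < ?s" using 4 n_ge \<sigma>_pos by (simp add: signal_def)
    have "?L \<le> expectation (\<lambda>\<omega>. ?p * (1 + ?s * D (rhat \<omega>) / real n))"
      by (intro expectation_rhat_mono rank_loss_le_signal q n_ge s)
    also have "\<dots> = ?p * (1 + ?s * (?D / real n))"
      using integrable_rhat[of D] by (simp add: prob_space)
    also have "\<dots> \<le> ?p * (1 + ?s * (3 / ?s + 8 * B))"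
      using D_le 4 s by (intro mult_left_mono add_left_mono) auto
    also have "\<dots> \<le> ?p * (44 + 8 * B)"
    proof (intro mult_left_mono)
      have "?s * (8 * B) \<le> 1 * (8 * B)" using 4 B0 by (intro mult_right_mono) auto
      then show "1 + ?s * (3 / ?s + 8 * B) \<le> 44 + 8 * B" using s by (simp add: distrib_left)
    qed simp
    finally have "?L \<le> (44 + 8 * B) * ?p" by (simp add: mult.commute)
    moreover have "?L \<le> (44 + 8 * B) * real n powr q"
    proof -
      have "1 * real n powr q \<le> (44 + 8 * B) * real n powr q" using B0 by (intro mult_right_mono) auto
      then show ?thesis using L_n by simp
    qed
    ultimately show ?thesis using 4 by (simp add: rate_def min_def)
  qed
qed

lemma prob_exact_recovery_ge:
  "1 - expectation (\<lambda>\<omega>. D (rhat \<omega>)) \<le> prob {\<omega> \<in> space M. rhat \<omega> = r}"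
proof -
  let ?A = "{\<omega> \<in> space M. rhat \<omega> = r}"
  have "prob (space M - ?A) = expectation (indicator (space M - ?A))"
    by simp
  also have "\<dots> \<le> expectation (\<lambda>\<omega>. D (rhat \<omega>))"
  proof (intro integral_mono integrable_rhat)
    fix \<omega> assume "\<omega> \<in> space M"
    then show "indicator (space M - ?A) \<omega> \<le> D (rhat \<omega>)"
      using one_le_sq_dist[OF r rhat_in] sq_dist_nonneg by (auto simp: indicator_def)
  qed (auto intro!: integrable_real_indicator simp: emeasure_eq_measure)
  finally show ?thesis
    by (simp add: prob_compl)
qed

end

section \<open>Asymptotics\<close>

theorem theorem3p1:
  fixes q :: real
    and c \<sigma> \<beta> :: "nat \<Rightarrow> real"
    and \<theta> :: "nat \<Rightarrow> nat \<Rightarrow> real"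
    and P :: "nat \<Rightarrow> (nat \<Rightarrow> nat) \<Rightarrow> 'a measure"
    and X :: "nat \<Rightarrow> nat \<Rightarrow> nat \<Rightarrow> 'a \<Rightarrow> real"
    and Z :: "nat \<Rightarrow> (nat \<Rightarrow> nat) \<Rightarrow> nat \<Rightarrow> nat \<Rightarrow> 'a \<Rightarrow> real"
    and rhat :: "nat \<Rightarrow> 'a \<Rightarrow> nat \<Rightarrow> nat"
  assumes q: "0 \<le> q" "q \<le> 2"
    and c_ge: "\<And>n. n \<ge> 1 \<Longrightarrow> 1 \<le> c n"
    and c_small: "c \<in> o(\<lambda>n. sqrt (real n))"
    and sigma_pos: "\<And>n. n \<ge> 1 \<Longrightarrow> 0 < \<sigma> n"
    and model: "\<And>n r. n \<ge> 1 \<Longrightarrow> r \<in> rank_space n (c n) \<Longrightarrow>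
                  differential_comparison_model (P n r) n (\<theta> n) r (X n) (Z n r)"
    and N: "\<And>n r. n \<ge> 1 \<Longrightarrow> r \<in> rank_space n (c n) \<Longrightarrow>
                  noise_condition (P n r) n (Z n r) (\<sigma> n)"
    and D1: "\<And>n. n \<ge> 1 \<Longrightarrow> cond_D1 n (c n) (\<theta> n) (\<beta> n)"
    and D2: "cond_D2 c \<theta> \<beta>"
    and rhat_measurable: "\<And>n r. n \<ge> 1 \<Longrightarrow> r \<in> rank_space n (c n) \<Longrightarrow>
                  rhat n \<in> measurable (P n r) (count_space (rank_space n (c n)))"
    and rhat_argmin: "\<And>n r \<omega>. n \<ge> 1 \<Longrightarrow> r \<in> rank_space n (c n) \<Longrightarrow> \<omega> \<in> space (P n r) \<Longrightarrow>
                  is_rank_estimate n (c n) (\<theta> n) (\<lambda>i j. X n i j \<omega>) (rhat n \<omega>)"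
  shows "(\<exists>C>0. \<exists>\<eta> :: nat \<Rightarrow> real. \<eta> \<longlonglongrightarrow> 0 \<and>
            (\<forall>n\<ge>1. (SUP r\<in>rank_space n (c n). \<integral>\<omega>. rank_loss q n (rhat n \<omega>) r \<partial>P n r)
                      \<le> C * rate q n (\<beta> n) (\<sigma> n) (\<eta> n)))
       \<and> (liminf (\<lambda>n. ereal (real n * (\<beta> n)\<^sup>2 / (4 * (\<sigma> n)\<^sup>2 * ln (real n)))) > 1 \<longrightarrow>
            (\<lambda>n. INF r\<in>rank_space n (c n).
                   measure (P n r) {\<omega> \<in> space (P n r). rhat n \<omega> = r}) \<longlonglongrightarrow> 1)"
proof -
  obtain \<epsilon> :: "nat \<Rightarrow> real" where \<epsilon>: "\<epsilon> \<longlonglongrightarrow> 0"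
    and Max_le: "\<And>n. n \<ge> 1 \<Longrightarrow>
        Max ((\<lambda>r. \<bar>(\<Sum>i=1..n. \<theta> n (r i)) - (\<Sum>i=1..n. \<theta> n i)\<bar>) ` rank_space n (c n))
          \<le> \<epsilon> n * sqrt (real n) * \<bar>\<beta> n\<bar>"
    using D2 unfolding cond_D2_def by auto
  have fixed_n: "rank_estimation (P n r) n (c n) (\<sigma> n) (\<beta> n) (\<epsilon> n) (\<theta> n) r (X n) (Z n r) (rhat n)"
    if n: "n \<ge> 1" and r: "r \<in> rank_space n (c n)" for n r
  proof (intro rank_estimation.intro rank_estimation_axioms.intro)
    show "prob_space (P n r)"
      using model[OF n r] by (simp add: differential_comparison_model_def)
    show "\<bar>(\<Sum>i=1..n. \<theta> n (r' i)) - (\<Sum>i=1..n. \<theta> n i)\<bar> \<le> \<epsilon> n * sqrt (real n) * \<bar>\<beta> n\<bar>"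
      if "r' \<in> rank_space n (c n)" for r'
      using that finite_rank_space by (intro order_trans[OF Max_ge Max_le[OF n]]) auto
  qed (use assms n r in auto)
  have nonempty: "rank_space n (c n) \<noteq> {}" if "n \<ge> 1" for n
    using c_ge[OF that] by (intro rank_space_nonempty) auto
  obtain K where K: "\<And>n. norm (\<epsilon> n) \<le> K"
    using convergent_imp_Bseq[OF convergentI[OF \<epsilon>]] by (auto simp: Bseq_def)
  have B: "(\<epsilon> n)\<^sup>2 \<le> K\<^sup>2" for n
    using power_mono[OF K norm_ge_zero, of n 2] by simp
  have "44 + 8 * K\<^sup>2 > 0"
    by (intro add_pos_nonneg) auto
  moreover have "(SUP r\<in>rank_space n (c n). \<integral>\<omega>. rank_loss q n (rhat n \<omega>) r \<partial>P n r)
      \<le> (44 + 8 * K\<^sup>2) * rate q n (\<beta> n) (\<sigma> n) (exponent_defect (\<epsilon> n))" if n: "n \<ge> 1" for n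
    by (intro cSUP_least nonempty n rank_estimation.expected_loss_le_rate[OF fixed_n q B])
  moreover have "(\<lambda>n. INF r\<in>rank_space n (c n).
      measure (P n r) {\<omega> \<in> space (P n r). rhat n \<omega> = r}) \<longlonglongrightarrow> 1"
    if liminf: "liminf (\<lambda>n. ereal (real n * (\<beta> n)\<^sup>2 / (4 * (\<sigma> n)\<^sup>2 * ln (real n)))) > 1"
  proof -
    let ?I = "\<lambda>n. INF r\<in>rank_space n (c n). measure (P n r) {\<omega> \<in> space (P n r). rhat n \<omega> = r}"
    obtain z where z: "1 < ereal z"
      "ereal z < liminf (\<lambda>n. ereal (real n * (\<beta> n)\<^sup>2 / (4 * (\<sigma> n)\<^sup>2 * ln (real n))))"
      using ereal_dense2[OF liminf] by auto
    then have z1: "1 < z" by simp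
    \<comment> \<open>Half of the margin \<open>z - 1\<close> is given away to the factor \<open>1 + \<eta>\<close> in the exponent.\<close>
    define w where "w = (1 + z) / 2"
    have w: "1 < w" "w / z < 1" using z1 by (auto simp: w_def)
    have "(\<lambda>n. 1 + exponent_defect (\<epsilon> n)) \<longlonglongrightarrow> 1 + 0"
      by (intro tendsto_intros exponent_defect_tendsto_0 \<epsilon>)
    then have "eventually (\<lambda>n. w / z < 1 + exponent_defect (\<epsilon> n)) sequentially"
      by (rule order_tendstoD) (use w in simp)
    moreover have "eventually (\<lambda>n. ereal z < ereal (real n * (\<beta> n)\<^sup>2 / (4 * (\<sigma> n)\<^sup>2 * ln (real n)))) sequentially"
      by (rule less_LiminfD[OF z(2)])
    moreover have "eventually (\<lambda>n. 32 * (\<epsilon> n)\<^sup>2 \<le> 1) sequentially"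
      by (rule exponent_defect_tendsto_0 \<epsilon>)+
    ultimately have lower: "eventually (\<lambda>n. 1 - 40 * real n powr (1 - w) \<le> ?I n) sequentially"
      using eventually_ge_at_top[of 3]
    proof eventually_elim
      case (elim n)
      then have n: "n \<ge> 1" by simp
      let ?s = "signal n (\<beta> n) (\<sigma> n)"
      \<comment> \<open>From \<open>n \<ge> 3\<close> on, \<open>ln n \<ge> 1\<close>, so the signal exceeds 1.\<close>
      have "exp 1 \<le> real n" using exp_le elim(4) by simp
      then have ln: "1 \<le> ln (real n)" using n by (simp add: ln_ge_iff)
      have zs: "z * ln (real n) < ?s"
        using elim(2) ln by (simp add: signal_def pos_less_divide_eq divide_divide_eq_left [symmetric]
            del: divide_divide_eq_left)
      moreover have "1 \<le> z * ln (real n)"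
        using mult_mono[of 1 z 1 "ln (real n)"] z1 ln by simp
      ultimately have s: "1 < ?s" by simp
      have "w / z * (z * ln (real n)) \<le> (1 + exponent_defect (\<epsilon> n)) * ?s"
        using elim(1) zs z1 w ln less_trans[OF _ elim(1), of 0] by (intro mult_mono) auto
      then have ws: "w * ln (real n) \<le> (1 + exponent_defect (\<epsilon> n)) * ?s"
        using z1 by simp
      have rate: "40 * real n * exp (- (1 + exponent_defect (\<epsilon> n)) * ?s) \<le> 40 * real n powr (1 - w)"
      proof -
        have "- (1 + exponent_defect (\<epsilon> n)) * ?s \<le> - (w * ln (real n))"
          using ws by (simp only: mult_minus_left neg_le_iff_le)
        then have "exp (- (1 + exponent_defect (\<epsilon> n)) * ?s) \<le> exp (- (w * ln (real n)))"
          by (simp only: exp_le_cancel_iff)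
        also have "\<dots> = real n powr (- w)"
          using n by (simp add: powr_def)
        finally have "40 * real n * exp (- (1 + exponent_defect (\<epsilon> n)) * ?s) \<le> 40 * real n * real n powr (- w)"
          by (rule mult_left_mono) simp
        also have "\<dots> = 40 * real n powr (1 - w)"
          using n powr_add[of "real n" 1 "- w"] by simp
        finally show ?thesis .
      qed
      show "1 - 40 * real n powr (1 - w) \<le> ?I n"
      proof (intro cINF_greatest nonempty n)
        fix r assume r: "r \<in> rank_space n (c n)"
        interpret rank_estimation "P n r" n "c n" "\<sigma> n" "\<beta> n" "\<epsilon> n" "\<theta> n" r "X n" "Z n r" "rhat n"
          by (rule fixed_n[OF n r])
        have "expectation (\<lambda>\<omega>. sq_dist n r (rhat n \<omega>))
            \<le> 40 * real n * exp (- (1 + exponent_defect (\<epsilon> n)) * ?s)"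
          by (rule expected_sq_dist_exp_defect_le[OF elim(3) s])
        then have "expectation (\<lambda>\<omega>. sq_dist n r (rhat n \<omega>)) \<le> 40 * real n powr (1 - w)"
          using rate by (rule order_trans)
        then show "1 - 40 * real n powr (1 - w) \<le> measure (P n r) {\<omega> \<in> space (P n r). rhat n \<omega> = r}"
          using prob_exact_recovery_ge by linarith
      qed
    qed
    have upper: "eventually (\<lambda>n. ?I n \<le> 1) sequentially"
      using eventually_ge_at_top[of 1]
    proof eventually_elim
      case (elim n)
      obtain r where r: "r \<in> rank_space n (c n)" using nonempty[OF elim] by blast
      interpret rank_estimation "P n r" n "c n" "\<sigma> n" "\<beta> n" "\<epsilon> n" "\<theta> n" r "X n" "Z n r" "rhat n"
        by (rule fixed_n[OF elim r])
      have "?I n \<le> measure (P n r) {\<omega> \<in> space (P n r). rhat n \<omega> = r}"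
        using r by (intro cINF_lower bdd_belowI2[where m = 0]) auto
      then show ?case using prob_le_1 by (rule order_trans)
    qed
    have "(\<lambda>n. real n powr (1 - w)) \<longlonglongrightarrow> 0"
      using w by (intro tendsto_neg_powr filterlim_real_sequentially) auto
    then have "(\<lambda>n. 1 - 40 * real n powr (1 - w)) \<longlonglongrightarrow> 1 - 40 * 0"
      by (intro tendsto_intros)
    then show ?thesis
      by (intro real_tendsto_sandwich[OF lower upper]) auto
  qed
  ultimately show ?thesis
    using exponent_defect_tendsto_0(1)[OF \<epsilon>] by blast
qed

end
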